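(* Let $X_1,X_2,\ldots,X_n$ be i.i.d. non-degenerate random variables taking values in a measurable space $(F,\mathcal{F})$. Then for all integers $\ell,m$ with $1\leq \ell+1\leq m\leq n$, \[R\left(\sum_{i=1}^{m}\delta_{X_i},\sum_{j=\ell+1}^{n}\delta_{X_j}\right)=\frac{m-\ell}{\sqrt{m(n-\ell)}},\] where $\delta_{x}$ is the Dirac measure at $x$.
   Context: For two random elements $X,Y$ (defined on a common probability space, with values in arbitrary measurable spaces), the maximal correlation coefficient is $R(X,Y)=\sup \rho(\varphi(X),\psi(Y))$, where $\rho$ denotes the Pearson correlation coefficient and the supremum is over all real-valued measurable functions $\varphi,\psi$ such that $\varphi(X)$ and $\psi(Y)$ are square-integrable with positive variance. A random element $X$ is degenerate if every real-valued measurable function of it is almost surely constant, and non-degenerate otherwise (equivalently, there is a measurable set $A$ with $0<P(X\in A)<1$). If $X$ or $Y$ is degenerate, one sets $R(X,Y)=0$. The sums $\sum_i\delta_{X_i}$ are random measures on $(F,\mathcal{F})$, i.e. random elements of the space of finite measures on $(F,\mathcal{F})$ with the $\sigma$-field generated by the evaluation maps $\mu\mapsto\mu(A)$, $A\in\mathcal{F}$. *)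

theory Defs
  imports "HOL-Probability.Probability"
begin

context prob_space
begin

definition covariance :: "('a \<Rightarrow> real) \<Rightarrow> ('a \<Rightarrow> real) \<Rightarrow> real" where
  "covariance U V = expectation (\<lambda>\<omega>. (U \<omega> - expectation U) * (V \<omega> - expectation V))"

definition correlation :: "('a \<Rightarrow> real) \<Rightarrow> ('a \<Rightarrow> real) \<Rightarrow> real" where
  "correlation U V = covariance U V / (sqrt (variance U) * sqrt (variance V))"

text \<open>
  A measure standing for the target space of a random element contributes only its space and
  sigma-algebra.
\<close>

definition degenerate :: "'b measure \<Rightarrow> ('a \<Rightarrow> 'b) \<Rightarrow> bool" where
  "degenerate S X \<longleftrightarrow> (\<forall>\<phi>\<in>borel_measurable S. \<exists>c::real. AE \<omega> in M. \<phi> (X \<omega>) = c)"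

definition admissible :: "'b measure \<Rightarrow> ('a \<Rightarrow> 'b) \<Rightarrow> ('b \<Rightarrow> real) \<Rightarrow> bool" where
  "admissible S X \<phi> \<longleftrightarrow>
     \<phi> \<in> borel_measurable S \<and>
     integrable M (\<lambda>\<omega>. (\<phi> (X \<omega>))\<^sup>2) \<and>
     variance (\<lambda>\<omega>. \<phi> (X \<omega>)) > 0"

text \<open>
  The supremum is taken in the reals: for measurable \<open>X\<close> and \<open>Y\<close> the correlations are bounded by
  1 (Cauchy--Schwarz), and if neither is degenerate the set is nonempty (take indicators of events
  of probability strictly between 0 and 1).
\<close>

definition maximal_correlation ::
    "'b measure \<Rightarrow> ('a \<Rightarrow> 'b) \<Rightarrow> 'c measure \<Rightarrow> ('a \<Rightarrow> 'c) \<Rightarrow> real" where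
  "maximal_correlation S X T Y =
     (if degenerate S X \<or> degenerate T Y then 0
      else Sup {correlation (\<lambda>\<omega>. \<phi> (X \<omega>)) (\<lambda>\<omega>. \<psi> (Y \<omega>)) | \<phi> \<psi>.
                  admissible S X \<phi> \<and> admissible T Y \<psi>})"

end

text \<open>
  The finite measures on \<open>F\<close> with the sigma-algebra generated by the evaluation maps; the
  analogue of \<^const>\<open>subprob_algebra\<close> without the bound on the total mass.
\<close>

definition finite_measure_algebra :: "'b measure \<Rightarrow> 'b measure measure" where
  "finite_measure_algebra F =
     (SUP A \<in> sets F.
        vimage_algebra {\<mu>. finite_measure \<mu> \<and> sets \<mu> = sets F} (\<lambda>\<mu>. emeasure \<mu> A) borel)"

text \<open>\<^term>\<open>return F x\<close> is the Dirac measure at \<open>x\<close> on \<open>F\<close>.\<close>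

definition sum_dirac :: "'b measure \<Rightarrow> 'i set \<Rightarrow> ('i \<Rightarrow> 'b) \<Rightarrow> 'b measure" where
  "sum_dirac F I x =
     measure_of (space F) (sets F) (\<lambda>A. \<Sum>i\<in>I. emeasure (return F (x i)) A)"

lemma space_sum_dirac [simp]: "space (sum_dirac F I x) = space F"
  by (simp add: sum_dirac_def)

lemma sets_sum_dirac [simp]: "sets (sum_dirac F I x) = sets F"
  by (simp add: sum_dirac_def)

lemma emeasure_sum_dirac:
  assumes "A \<in> sets F"
  shows "emeasure (sum_dirac F I x) A = (\<Sum>i\<in>I. emeasure (return F (x i)) A)"
proof (rule emeasure_measure_of[OF sum_dirac_def])
  show "countably_additive (sets (sum_dirac F I x)) (\<lambda>A. \<Sum>i\<in>I. emeasure (return F (x i)) A)"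
  proof (rule countably_additiveI)
    fix B :: "nat \<Rightarrow> _"
    assume B: "range B \<subseteq> sets (sum_dirac F I x)" "disjoint_family B"
    have "(\<Sum>k. \<Sum>i\<in>I. emeasure (return F (x i)) (B k)) =
          (\<Sum>i\<in>I. \<Sum>k. emeasure (return F (x i)) (B k))"
      by (rule suminf_sum) simp
    also have "\<dots> = (\<Sum>i\<in>I. emeasure (return F (x i)) (\<Union>k. B k))"
      using B by (intro sum.cong refl suminf_emeasure) auto
    finally show "(\<Sum>k. \<Sum>i\<in>I. emeasure (return F (x i)) (B k)) =
                  (\<Sum>i\<in>I. emeasure (return F (x i)) (\<Union>k. B k))" .
  qed
qed (use assms sets.space_closed in \<open>auto simp: positive_def\<close>)

lemma finite_measure_sum_dirac: "finite I \<Longrightarrow> finite_measure (sum_dirac F I x)"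
  by (intro finite_measureI) (auto simp: emeasure_sum_dirac indicator_def)

lemma space_finite_measure_algebra:
  "space (finite_measure_algebra F) = {\<mu>. finite_measure \<mu> \<and> sets \<mu> = sets F}"
  by (auto simp: finite_measure_algebra_def space_Sup_eq_UN)

lemma measurable_emeasure_finite_measure_algebra [measurable]:
  "A \<in> sets F \<Longrightarrow> (\<lambda>\<mu>. emeasure \<mu> A) \<in> borel_measurable (finite_measure_algebra F)"
  by (auto intro!: measurable_Sup1 measurable_vimage_algebra1 simp: finite_measure_algebra_def)

lemma measurable_sum_dirac:
  assumes "finite I" and X: "\<And>i. i \<in> I \<Longrightarrow> X i \<in> measurable M F"
  shows "(\<lambda>\<omega>. sum_dirac F I (\<lambda>i. X i \<omega>)) \<in> measurable M (finite_measure_algebra F)"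
  unfolding finite_measure_algebra_def
proof (rule measurable_Sup2)
  fix N assume "N \<in> (\<lambda>A. vimage_algebra {\<mu>. finite_measure \<mu> \<and> sets \<mu> = sets F}
                          (\<lambda>\<mu>. emeasure \<mu> A) borel) ` sets F"
  then obtain A where A: "A \<in> sets F"
    and N: "N = vimage_algebra {\<mu>. finite_measure \<mu> \<and> sets \<mu> = sets F} (\<lambda>\<mu>. emeasure \<mu> A) borel"
    by auto
  have "(\<lambda>\<omega>. \<Sum>i\<in>I. indicator A (X i \<omega>) :: ennreal) \<in> borel_measurable M"
    using X A by (intro borel_measurable_sum measurable_compose[OF X]) auto
  then show "(\<lambda>\<omega>. sum_dirac F I (\<lambda>i. X i \<omega>)) \<in> measurable M N"
    unfolding N using assms(1) A
    by (intro measurable_vimage_algebra2) (auto simp: emeasure_sum_dirac finite_measure_sum_dirac)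
qed auto

end

theory Submission
  imports Defs
begin

text \<open>
  Upper bound: functions of the two sums of Dirac measures are functions \<open>f\<close>, \<open>g\<close> of the coordinates
  in \<open>S\<close> and \<open>T\<close>, symmetric in these coordinates. By independence, integrating out the coordinates
  outside \<open>S \<inter> T\<close> does not change the covariance, so by Cauchy--Schwarz it suffices that averaging
  a symmetric \<open>f\<close> over all but \<open>r\<close> of its \<open>s\<close> coordinates shrinks the variance at least by the
  factor \<open>r / s\<close>. This holds because the variance is a convex function of the number of averaged
  coordinates (which ends in 0), a second difference being the second moment of
  \<open>(1 - A\<^sub>i) (1 - A\<^sub>j) h\<close> for the commuting averaging projections \<open>A\<^sub>i\<close>, \<open>A\<^sub>j\<close>. Everything is done
  for bounded functions, where Fubini applies pointwise, and extended to square-integrable ones by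
  truncation.

  The bound is attained by \<open>\<nu> \<mapsto> \<nu>(A)\<close> for any \<open>A\<close> with \<open>0 < P(X\<^sub>i \<in> A) < 1\<close>.
\<close>

section \<open>Coordinate averages on a finite power of a probability space\<close>

locale finite_power_prob = prob_space P for P :: "'b measure" +
  fixes I :: "'i set"
  assumes finite_index: "finite I"
begin

abbreviation power_measure :: "('i \<Rightarrow> 'b) measure" where
  "power_measure \<equiv> Pi\<^sub>M I (\<lambda>_. P)"

text \<open>The bound holds at every point of the type, also outside
  \<open>space power_measure\<close>, so it passes to \<open>x(i := y)\<close> without side
  conditions.\<close>

definition bdd_measurable :: "(('i \<Rightarrow> 'b) \<Rightarrow> real) \<Rightarrow> bool" where
  "bdd_measurable h \<longleftrightarrow> h \<in> borel_measurable power_measure \<and> (\<exists>C. \<forall>x. \<bar>h x\<bar> \<le> C)"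

text \<open>A pointwise version of the conditional expectation given all coordinates except
  \<open>i\<close>; idempotence and similar identities then hold exactly and not just almost
  everywhere.\<close>

definition avg :: "'i \<Rightarrow> (('i \<Rightarrow> 'b) \<Rightarrow> real) \<Rightarrow> ('i \<Rightarrow> 'b) \<Rightarrow> real" where
  "avg i h x = (\<integral>y. h (x(i := y)) \<partial>P)"

abbreviation E :: "(('i \<Rightarrow> 'b) \<Rightarrow> real) \<Rightarrow> real" where
  "E h \<equiv> integral\<^sup>L power_measure h"

sublocale prod: product_prob_space "\<lambda>_. P" I ..

lemma bdd_measurableD: "bdd_measurable h \<Longrightarrow> h \<in> borel_measurable power_measure"
  by (simp add: bdd_measurable_def)

lemma integrable_bdd_measurable: "bdd_measurable h \<Longrightarrow> integrable power_measure h"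
  by (auto simp: bdd_measurable_def intro!: prod.P.integrable_const_bound AE_I2)

lemma bdd_measurable_const [simp]: "bdd_measurable (\<lambda>_. c)"
  by (auto simp: bdd_measurable_def)

lemma bdd_measurable_add:
  assumes "bdd_measurable f" "bdd_measurable g"
  shows "bdd_measurable (\<lambda>x. f x + g x)"
proof -
  obtain C D where "\<And>x. \<bar>f x\<bar> \<le> C" "\<And>x. \<bar>g x\<bar> \<le> D"
    using assms by (auto simp: bdd_measurable_def)
  then have "\<bar>f x + g x\<bar> \<le> C + D" for x
    by (meson abs_triangle_ineq add_mono order_trans)
  then show ?thesis
    using assms by (auto simp: bdd_measurable_def)
qed

lemma bdd_measurable_mult:
  assumes "bdd_measurable f" "bdd_measurable g"
  shows "bdd_measurable (\<lambda>x. f x * g x)"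
proof -
  obtain C D where "\<And>x. \<bar>f x\<bar> \<le> C" "\<And>x. \<bar>g x\<bar> \<le> D"
    using assms by (auto simp: bdd_measurable_def)
  then have "\<bar>f x * g x\<bar> \<le> C * D" for x
    unfolding abs_mult by (meson abs_ge_zero mult_mono order_trans)
  then show ?thesis
    using assms by (auto simp: bdd_measurable_def)
qed

lemma bdd_measurable_diff:
  assumes "bdd_measurable f" "bdd_measurable g"
  shows "bdd_measurable (\<lambda>x. f x - g x)"
  using bdd_measurable_add[OF assms(1) bdd_measurable_mult[OF bdd_measurable_const[of "-1"] assms(2)]]
  by simp

lemma bdd_measurable_power2: "bdd_measurable f \<Longrightarrow> bdd_measurable (\<lambda>x. (f x)\<^sup>2)"
  by (simp add: power2_eq_square bdd_measurable_mult)

lemma measurable_update: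
  assumes "i \<in> I"
  shows "(\<lambda>(x, y). x(i := y)) \<in> measurable (power_measure \<Otimes>\<^sub>M P) power_measure"
  using measurable_add_dim[of i I "\<lambda>_. P"] assms by (simp add: insert_absorb)

lemma measurable_slice:
  assumes "bdd_measurable h" "i \<in> I" "x \<in> space power_measure"
  shows "(\<lambda>y. h (x(i := y))) \<in> borel_measurable P"
proof -
  have "(\<lambda>y. x(i := y)) \<in> measurable P power_measure"
    using measurable_compose[OF measurable_Pair1'[OF assms(3)] measurable_update[OF assms(2)]] by simp
  then show ?thesis
    using assms(1) by (auto simp: bdd_measurable_def intro: measurable_compose)
qed

lemma integrable_slice:
  assumes "bdd_measurable h" "i \<in> I" "x \<in> space power_measure"
  shows "integrable P (\<lambda>y. h (x(i := y)))"
proof -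
  obtain C where "\<And>x. \<bar>h x\<bar> \<le> C"
    using assms by (auto simp: bdd_measurable_def)
  then show ?thesis
    using measurable_slice[OF assms] by (intro integrable_const_bound[where B=C]) auto
qed

lemma bdd_measurable_avg:
  assumes "bdd_measurable h" "i \<in> I"
  shows "bdd_measurable (avg i h)"
proof -
  obtain C where C: "\<And>x. \<bar>h x\<bar> \<le> C"
    using assms by (auto simp: bdd_measurable_def)
  have "0 \<le> C"
    using C[of undefined] by linarith
  have "\<bar>avg i h x\<bar> \<le> C" for x
  proof -
    have "norm (\<integral>y. h (x(i := y)) \<partial>P) \<le> (\<integral>y. norm (h (x(i := y))) \<partial>P)"
      by simp
    also have "\<dots> \<le> C"
    \<comment> \<open>The bound is claimed for every \<open>x\<close>. Outside the space the slice
      may fail to be integrable; the integral then has the default value 0, which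
      \<open>0 \<le> C\<close> covers.\<close>
    proof (cases "integrable P (\<lambda>y. h (x(i := y)))")
      case True
      then show ?thesis
        using C by (intro integral_le_const) auto
    next
      case False
      then have "(\<integral>y. h (x(i := y)) \<partial>P) = 0"
        by (rule not_integrable_integral_eq)
      show ?thesis
      proof (cases "integrable P (\<lambda>y. norm (h (x(i := y))))")
        case True
        then show ?thesis using C by (intro integral_le_const) auto
      next
        case False
        then show ?thesis using \<open>0 \<le> C\<close> by (simp add: not_integrable_integral_eq)
      qed
    qed
    finally show ?thesis by (simp add: avg_def)
  qed
  moreover have "(\<lambda>(x, y). h (x(i := y))) \<in> borel_measurable (power_measure \<Otimes>\<^sub>M P)"
    using measurable_compose[OF measurable_update[OF assms(2)] bdd_measurableD[OF assms(1)]]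
    by (simp add: case_prod_beta)
  then have "avg i h \<in> borel_measurable power_measure"
    unfolding avg_def [abs_def] by (rule borel_measurable_lebesgue_integral)
  ultimately show ?thesis
    by (auto simp: bdd_measurable_def)
qed

lemma avg_update [simp]: "avg i h (x(i := y)) = avg i h x"
  by (simp add: avg_def)

text \<open>By Fubini, \<open>E g\<close> depends on \<open>g\<close> only through
  \<open>avg i g\<close>, and \<open>avg i\<close> is idempotent.\<close>

lemma E_avg:
  assumes "bdd_measurable h" "i \<in> I"
  shows "E (avg i h) = E h"
proof -
  have split: "E g = (\<integral>x. avg i g x \<partial>Pi\<^sub>M (I - {i}) (\<lambda>_. P))" if "bdd_measurable g" for g
    using prod.product_integral_insert[of "I - {i}" i g] that finite_index assms(2)
    by (simp add: insert_absorb avg_def integrable_bdd_measurable)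
  have "avg i (avg i h) = avg i h"
    by (rule ext) (simp add: avg_def prob_space)
  then show ?thesis
    using split[OF assms(1)] split[OF bdd_measurable_avg[OF assms]] by simp
qed

text \<open>The factor \<open>avg i g\<close> does not depend on coordinate \<open>i\<close>, so it
  can be pulled out of the average of the product.\<close>

lemma E_mult_avg:
  assumes "bdd_measurable f" "bdd_measurable g" "i \<in> I"
  shows "E (\<lambda>x. f x * avg i g x) = E (\<lambda>x. avg i f x * avg i g x)"
proof -
  have "avg i (\<lambda>x. f x * avg i g x) x = avg i f x * avg i g x" for x
    by (subst avg_def) (simp add: avg_def[of _ f])
  then have "avg i (\<lambda>x. f x * avg i g x) = (\<lambda>x. avg i f x * avg i g x)"
    by (rule ext)
  with E_avg[OF bdd_measurable_mult[OF assms(1) bdd_measurable_avg[OF assms(2,3)]] assms(3)]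
  show ?thesis by simp
qed

text \<open>Self-adjointness of \<open>avg i\<close>: both sides equal
  \<open>E (\<lambda>x. avg i f x * avg i g x)\<close>.\<close>

lemma E_avg_mult:
  assumes "bdd_measurable f" "bdd_measurable g" "i \<in> I"
  shows "E (\<lambda>x. avg i f x * g x) = E (\<lambda>x. f x * avg i g x)"
  using E_mult_avg[OF assms] E_mult_avg[OF assms(2,1,3)] by (simp add: mult.commute)

text \<open>Fubini on \<open>P \<Otimes>\<^sub>M P\<close> for the slice of \<open>h\<close> in the
  coordinates \<open>i\<close> and \<open>j\<close>. That \<open>x\<close> lies in the space makes
  this slice measurable.\<close>

lemma avg_commute:
  assumes "bdd_measurable h" "i \<in> I" "j \<in> I" "x \<in> space power_measure"
  shows "avg i (avg j h) x = avg j (avg i h) x"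
proof (cases "i = j")
  case False
  interpret pair_prob_space P P ..
  obtain C where C: "\<And>x. \<bar>h x\<bar> \<le> C"
    using assms by (auto simp: bdd_measurable_def)
  have "(\<lambda>z. (x, fst z)) \<in> measurable (P \<Otimes>\<^sub>M P) (power_measure \<Otimes>\<^sub>M P)"
    using assms(4) by (intro measurable_Pair) auto
  from measurable_compose[OF this measurable_update[OF assms(2)]]
  have "(\<lambda>z. x(i := fst z)) \<in> measurable (P \<Otimes>\<^sub>M P) power_measure"
    by simp
  then have "(\<lambda>z. (x(i := fst z), snd z)) \<in> measurable (P \<Otimes>\<^sub>M P) (power_measure \<Otimes>\<^sub>M P)"
    by (intro measurable_Pair) auto
  from measurable_compose[OF this measurable_update[OF assms(3)]]
  have "(\<lambda>z. x(i := fst z, j := snd z)) \<in> measurable (P \<Otimes>\<^sub>M P) power_measure"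
    by simp
  from measurable_compose[OF this bdd_measurableD[OF assms(1)]]
  have "integrable (P \<Otimes>\<^sub>M P) (\<lambda>(y, z). h (x(i := y, j := z)))"
    using C by (intro P.integrable_const_bound[where B=C]) (auto simp: case_prod_beta)
  from Fubini_integral[OF this] show ?thesis
    using False by (simp add: avg_def fun_upd_twist)
qed simp

section \<open>Independence of a coordinate, symmetry in two coordinates, and iterated
  averages\<close>

definition invariant :: "'i \<Rightarrow> (('i \<Rightarrow> 'b) \<Rightarrow> real) \<Rightarrow> bool" where
  "invariant i h \<longleftrightarrow> (\<forall>x y. h (x(i := y)) = h x)"

text \<open>The two values are written into \<open>x\<close> instead of being exchanged in it, which
  matches the slices that iterated averages integrate over.\<close>

definition symmetric2 :: "'i \<Rightarrow> 'i \<Rightarrow> (('i \<Rightarrow> 'b) \<Rightarrow> real) \<Rightarrow> bool" where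
  "symmetric2 i j h \<longleftrightarrow> (\<forall>x a b. h (x(i := a, j := b)) = h (x(i := b, j := a)))"

lemma avg_invariant: "invariant i h \<Longrightarrow> avg i h = h"
  by (rule ext) (simp add: avg_def invariant_def prob_space)

lemma invariant_avg_same: "invariant i (avg i h)"
  by (simp add: invariant_def)

lemma invariant_avg:
  assumes "invariant i h"
  shows "invariant i (avg j h)"
proof (cases "i = j")
  case False
  have "h (x(i := y, j := z)) = h (x(j := z))" for x y z
    using assms by (subst fun_upd_twist[OF False]) (simp add: invariant_def)
  then show ?thesis
    by (simp add: invariant_def avg_def)
qed (simp add: invariant_avg_same)

lemma symmetric2_avg:
  assumes "symmetric2 i j h" "k \<noteq> i" "k \<noteq> j"
  shows "symmetric2 i j (avg k h)"
proof -
  have "x(i := a, j := b, k := c) = x(k := c, i := a, j := b)" for x :: "'i \<Rightarrow> 'b" and a b c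
    using assms by (auto simp: fun_eq_iff)
  then show ?thesis
    using assms(1) by (simp add: symmetric2_def avg_def)
qed

lemma bdd_measurable_fold:
  "bdd_measurable h \<Longrightarrow> set zs \<subseteq> I \<Longrightarrow> bdd_measurable (fold avg zs h)"
  by (induction zs arbitrary: h) (auto intro: bdd_measurable_avg)

lemma E_fold:
  "bdd_measurable h \<Longrightarrow> set zs \<subseteq> I \<Longrightarrow> E (fold avg zs h) = E h"
  by (induction zs arbitrary: h) (auto simp: E_avg bdd_measurable_avg)

lemma invariant_fold: "invariant i h \<or> i \<in> set zs \<Longrightarrow> invariant i (fold avg zs h)"
  by (induction zs arbitrary: h) (auto simp: invariant_avg invariant_avg_same)

lemma fold_invariant: "(\<And>i. i \<in> set zs \<Longrightarrow> invariant i h) \<Longrightarrow> fold avg zs h = h"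
  by (induction zs arbitrary: h) (auto simp: avg_invariant)

lemma symmetric2_fold:
  "symmetric2 i j h \<Longrightarrow> i \<notin> set zs \<Longrightarrow> j \<notin> set zs \<Longrightarrow> symmetric2 i j (fold avg zs h)"
  by (induction zs arbitrary: h) (auto simp: symmetric2_avg)

text \<open>The adjoint of a composition composes the adjoints in reverse order. Keeping
  \<open>rev\<close> spares a reordering of the averages, whose commutation is established only on
  the space.\<close>

lemma E_fold_mult:
  assumes "bdd_measurable f" "bdd_measurable g" "set zs \<subseteq> I"
  shows "E (\<lambda>x. fold avg zs f x * g x) = E (\<lambda>x. f x * fold avg (rev zs) g x)"
  using assms
proof (induction zs arbitrary: f)
  case (Cons i zs)
  have "E (\<lambda>x. fold avg (i # zs) f x * g x) = E (\<lambda>x. avg i f x * fold avg (rev zs) g x)"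
    using Cons by (simp add: bdd_measurable_avg)
  also have "\<dots> = E (\<lambda>x. f x * avg i (fold avg (rev zs) g) x)"
    using Cons.prems by (intro E_avg_mult bdd_measurable_fold) auto
  finally show ?case by simp
qed simp

text \<open>Any point of the space is reached from any other by changing one coordinate at a time,
  and there are finitely many of them.\<close>

lemma invariant_imp_const:
  assumes "\<And>i. i \<in> I \<Longrightarrow> invariant i h" "x \<in> space power_measure"
  shows "h x = E h"
proof -
  have "h y = h x" if y: "y \<in> space power_measure" for y
  proof -
    have "h (\<lambda>i. if i \<in> J then y i else x i) = h x" if "finite J" "J \<subseteq> I" for J
      using that
    proof (induction J)
      case (insert j J)
      have "(\<lambda>i. if i \<in> insert j J then y i else x i) =
            (\<lambda>i. if i \<in> J then y i else x i)(j := y j)"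
        by auto
      with insert assms(1)[of j] show ?case
        by (simp only: invariant_def) auto
    qed simp
    from this[OF finite_index] have "h (\<lambda>i. if i \<in> I then y i else x i) = h x"
      by simp
    \<comment> \<open>Outside \<open>I\<close> both points take the value \<open>undefined\<close>,
      since elements of the product space are extensional.\<close>
    moreover have "(\<lambda>i. if i \<in> I then y i else x i) = y"
      using y assms(2) by (auto simp: space_PiM PiE_def extensional_def)
    ultimately show ?thesis by simp
  qed
  then have "E h = E (\<lambda>_. h x)"
    by (intro Bochner_Integration.integral_cong) auto
  then show ?thesis
    by (simp add: prod.P.prob_space)
qed

section \<open>Second moments under averaging\<close>

lemma E_diff_avg_power2:
  assumes "bdd_measurable h" "i \<in> I"
  shows "E (\<lambda>x. (h x - avg i h x)\<^sup>2) = E (\<lambda>x. (h x)\<^sup>2) - E (\<lambda>x. (avg i h x)\<^sup>2)"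
proof -
  note bdd = assms(1) bdd_measurable_avg[OF assms]
  note int = bdd[THEN bdd_measurable_power2, THEN integrable_bdd_measurable]
  have "integrable power_measure (\<lambda>x. h x * avg i h x)"
    by (rule integrable_bdd_measurable[OF bdd_measurable_mult[OF bdd]])
  then have "E (\<lambda>x. (h x - avg i h x)\<^sup>2) =
      E (\<lambda>x. (h x)\<^sup>2) - 2 * E (\<lambda>x. h x * avg i h x) + E (\<lambda>x. (avg i h x)\<^sup>2)"
    using int by (simp add: power2_diff mult.assoc)
  \<comment> \<open>Pythagoras for the orthogonal projection \<open>avg i\<close>: the cross term
    equals the second moment of \<open>avg i h\<close>.\<close>
  then show ?thesis
    using E_mult_avg[OF assms(1) assms] by (simp add: power2_eq_square)
qed

lemma E_avg_power2_le:
  assumes "bdd_measurable h" "i \<in> I"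
  shows "E (\<lambda>x. (avg i h x)\<^sup>2) \<le> E (\<lambda>x. (h x)\<^sup>2)"
proof -
  have "0 \<le> E (\<lambda>x. (h x - avg i h x)\<^sup>2)"
    by simp
  then show ?thesis
    using E_diff_avg_power2[OF assms] by simp
qed

text \<open>By symmetry, \<open>avg i h\<close> depends on coordinate \<open>j\<close> exactly as
  \<open>avg j h\<close> depends on coordinate \<open>i\<close>. Averaging out this remaining
  coordinate makes the two squares coincide.\<close>

lemma E_avg_power2_swap:
  assumes "bdd_measurable h" "symmetric2 i j h" "i \<in> I" "j \<in> I" "i \<noteq> j"
  shows "E (\<lambda>x. (avg i h x)\<^sup>2) = E (\<lambda>x. (avg j h x)\<^sup>2)"
proof -
  have "h (x(j := w, i := u)) = h (x(i := w, j := u))" for x u w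
    using assms(2,5) by (metis fun_upd_twist symmetric2_def)
  then have "avg j (\<lambda>x. (avg i h x)\<^sup>2) = avg i (\<lambda>x. (avg j h x)\<^sup>2)"
    by (simp add: avg_def fun_eq_iff)
  then show ?thesis
    using E_avg[OF bdd_measurable_power2[OF bdd_measurable_avg], of h i j]
      E_avg[OF bdd_measurable_power2[OF bdd_measurable_avg], of h j i] assms
    by simp
qed

text \<open>The reason is that \<open>h - avg i h\<close> does not gain second moment under \<open>avg j\<close>.\<close>

lemma E_avg_avg_power2_convex:
  assumes h: "bdd_measurable h" "symmetric2 i j h" and ij: "i \<in> I" "j \<in> I" "i \<noteq> j"
  shows "2 * E (\<lambda>x. (avg i h x)\<^sup>2) \<le> E (\<lambda>x. (h x)\<^sup>2) + E (\<lambda>x. (avg j (avg i h) x)\<^sup>2)"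
proof -
  define u where "u x = h x - avg i h x" for x
  have u: "bdd_measurable u"
    unfolding u_def using h ij by (intro bdd_measurable_diff bdd_measurable_avg)
  \<comment> \<open>Commuting the averages gives \<open>avg j u\<close> the form
    \<open>k - avg i k\<close> with \<open>k = avg j h\<close>, so that
    \<open>E_diff_avg_power2\<close> applies to it as it does to \<open>u\<close>.\<close>
  have "avg j u x = avg j h x - avg i (avg j h) x" if "x \<in> space power_measure" for x
  proof -
    have "avg j u x = avg j h x - avg j (avg i h) x"
      unfolding avg_def[of j] u_def using h ij that
      by (intro Bochner_Integration.integral_diff integrable_slice bdd_measurable_avg)
    then show ?thesis
      using avg_commute[OF h(1) ij(2,1) that] by simp
  qed
  then have "E (\<lambda>x. (avg j u x)\<^sup>2) = E (\<lambda>x. (avg j h x - avg i (avg j h) x)\<^sup>2)"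
    by (intro Bochner_Integration.integral_cong) auto
  also have "\<dots> = E (\<lambda>x. (avg j h x)\<^sup>2) - E (\<lambda>x. (avg i (avg j h) x)\<^sup>2)"
    using h ij by (intro E_diff_avg_power2 bdd_measurable_avg)
  also have "E (\<lambda>x. (avg j h x)\<^sup>2) = E (\<lambda>x. (avg i h x)\<^sup>2)"
    using E_avg_power2_swap[OF h ij] by simp
  also have "E (\<lambda>x. (avg i (avg j h) x)\<^sup>2) = E (\<lambda>x. (avg j (avg i h) x)\<^sup>2)"
    using avg_commute[OF h(1) ij(1,2)] by (intro Bochner_Integration.integral_cong) auto
  finally show ?thesis
    using E_avg_power2_le[OF u ij(2)] E_diff_avg_power2[OF h(1) ij(1)]
    by (simp add: u_def [abs_def])
qed

lemma E_Cauchy_Schwarz: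
  assumes "bdd_measurable u" "bdd_measurable v"
  shows "\<bar>E (\<lambda>x. u x * v x)\<bar> \<le> sqrt (E (\<lambda>x. (u x)\<^sup>2)) * sqrt (E (\<lambda>x. (v x)\<^sup>2))"
proof -
  define A where "A = E (\<lambda>x. (u x)\<^sup>2)"
  define B where "B = E (\<lambda>x. u x * v x)"
  define C where "C = E (\<lambda>x. (v x)\<^sup>2)"
  have int: "integrable power_measure (\<lambda>x. (u x)\<^sup>2)" "integrable power_measure (\<lambda>x. (v x)\<^sup>2)"
      "integrable power_measure (\<lambda>x. u x * v x)"
    using assms by (auto intro!: integrable_bdd_measurable bdd_measurable_power2 bdd_measurable_mult)
  have quad: "0 \<le> a\<^sup>2 * A + 2 * a * b * B + b\<^sup>2 * C" for a b :: real
  proof -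
    have "0 \<le> E (\<lambda>x. (a * u x + b * v x)\<^sup>2)"
      by simp
    also have "(\<lambda>x. (a * u x + b * v x)\<^sup>2) =
        (\<lambda>x. a\<^sup>2 * (u x)\<^sup>2 + 2 * a * b * (u x * v x) + b\<^sup>2 * (v x)\<^sup>2)"
      by (auto simp: power2_eq_square algebra_simps)
    also have "E \<dots> = a\<^sup>2 * A + 2 * a * b * B + b\<^sup>2 * C"
      using int by (simp add: A_def B_def C_def)
    finally show ?thesis .
  qed
  have nonneg: "0 \<le> A" "0 \<le> C"
    by (simp_all add: A_def C_def)
  have "B\<^sup>2 \<le> A * C"
  proof (cases "A = 0")
    case True
    have "B = 0"
    proof (rule ccontr)
      \<comment> \<open>With \<open>A = 0\<close> and \<open>b = 1\<close> the form is
        \<open>2 * a * B + C\<close>, linear in \<open>a\<close>; the chosen \<open>a\<close> makes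
        it -1.\<close>
      assume "B \<noteq> 0"
      with quad[of "- (C + 1) / (2 * B)" 1] True show False
        by (simp add: field_simps)
    qed
    with True show ?thesis by simp
  next
    case False
    \<comment> \<open>The form at \<open>a = - B\<close>, \<open>b = A\<close>, its minimum in
      \<open>a\<close> for this \<open>b\<close>.\<close>
    have "0 \<le> A * (A * C - B\<^sup>2)"
      using quad[of "- B" A] by (simp add: power2_eq_square algebra_simps)
    with False nonneg show ?thesis
      by (simp add: zero_le_mult_iff)
  qed
  then show ?thesis
    using real_sqrt_le_mono[of "B\<^sup>2" "A * C"] by (simp add: real_sqrt_mult A_def B_def C_def)
qed

end

section \<open>Integrability of products, and a bound for convex sequences\<close>

lemma integrable_mult_of_squares:
  fixes h k :: "'a \<Rightarrow> real"
  assumes [measurable]: "h \<in> borel_measurable M" "k \<in> borel_measurable M"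
    and "integrable M (\<lambda>x. (h x)\<^sup>2)" "integrable M (\<lambda>x. (k x)\<^sup>2)"
  shows "integrable M (\<lambda>x. h x * k x)"
proof (rule Bochner_Integration.integrable_bound)
  show "integrable M (\<lambda>x. (h x)\<^sup>2 + (k x)\<^sup>2)"
    using assms by simp
  have "\<bar>a * b\<bar> \<le> a\<^sup>2 + b\<^sup>2" for a b :: real
  proof -
    have "2 * \<bar>a * b\<bar> \<le> a\<^sup>2 + b\<^sup>2"
      using sum_squares_bound[of "\<bar>a\<bar>" "\<bar>b\<bar>"] by (simp add: abs_mult)
    then show ?thesis
      using abs_ge_zero[of "a * b"] by linarith
  qed
  then show "AE x in M. norm (h x * k x) \<le> norm ((h x)\<^sup>2 + (k x)\<^sup>2)"
    by simp
qed measurable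

text \<open>A convex sequence lies below its chord: the decrements \<open>a k - a (Suc k)\<close>
  are antitone, so the one at \<open>l\<close> is at most the mean of those before it and at least
  the mean of those from \<open>l\<close> on.\<close>

lemma convex_sequence_bound:
  fixes a :: "nat \<Rightarrow> real"
  assumes "\<And>k. Suc (Suc k) \<le> m \<Longrightarrow> 2 * a (Suc k) \<le> a k + a (Suc (Suc k))" and "l \<le> m"
  shows "real m * (a l - a m) \<le> real (m - l) * (a 0 - a m)"
proof (cases "l = m")
  case False
  with assms(2) have "l < m" by simp
  define d where "d k = a k - a (Suc k)" for k
  have d: "d k' \<le> d k" if "k \<le> k'" "k' < m" for k k'
    using that
  proof (induction k' rule: dec_induct)
    case (step i)
    then show ?case using assms(1)[of i] by (simp add: d_def)
  qed simp
  have "real l * d l \<le> (\<Sum>k<l. d k)"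
    using sum_bounded_below[of "{..<l}" "d l" d] d \<open>l < m\<close> by simp
  also have "\<dots> = a 0 - a l"
    unfolding d_def by (rule sum_lessThan_telescope')
  finally have 1: "real l * d l \<le> a 0 - a l" .
  have "a l - a m = (\<Sum>k=l..<m. d k)"
    unfolding d_def using sum_Suc_diff'[OF assms(2), of a] by (simp add: sum_subtractf)
  also have "\<dots> \<le> real (m - l) * d l"
    using sum_bounded_above[of "{l..<m}" d "d l"] d by simp
  finally have 2: "a l - a m \<le> real (m - l) * d l" .
  have "real l * (a l - a m) \<le> real (m - l) * (real l * d l)"
    using mult_left_mono[OF 2, of "real l"] by (simp add: mult_ac)
  also have "\<dots> \<le> real (m - l) * (a 0 - a l)"
    using 1 by (intro mult_left_mono) auto
  \<comment> \<open>Add \<open>real (m - l) * (a l - a m)\<close> to both sides.\<close>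
  finally show ?thesis
    using assms(2) by (simp add: of_nat_diff algebra_simps)
qed simp

section \<open>Shrinking of the variance, and the covariance bound for bounded functions\<close>

context finite_power_prob
begin

text \<open>The second moments after averaging over the prefixes of \<open>zs\<close> form a convex
  sequence, because averaging over a prefix keeps the symmetry in the coordinates still to come. It
  ends in \<open>(E f)\<^sup>2\<close>, as averaging over all of \<open>zs\<close> leaves a
  constant.\<close>

lemma variance_fold_le:
  assumes f: "bdd_measurable f" and zs: "distinct zs" "set zs \<subseteq> I"
    and sym: "\<And>i j. i \<in> set zs \<Longrightarrow> j \<in> set zs \<Longrightarrow> i \<noteq> j \<Longrightarrow> symmetric2 i j f"
    and inv: "\<And>i. i \<in> I - set zs \<Longrightarrow> invariant i f"
    and l: "l \<le> length zs"
  shows "real (length zs) * (E (\<lambda>x. (fold avg (take l zs) f x)\<^sup>2) - (E f)\<^sup>2)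
    \<le> real (length zs - l) * (E (\<lambda>x. (f x)\<^sup>2) - (E f)\<^sup>2)"
proof -
  define a where "a k = E (\<lambda>x. (fold avg (take k zs) f x)\<^sup>2)" for k
  have "fold avg zs f x = E f" if "x \<in> space power_measure" for x
    using invariant_imp_const[OF _ that, of "fold avg zs f"] inv E_fold[OF f zs(2)]
    by (auto intro!: invariant_fold)
  then have "E (\<lambda>x. (fold avg zs f x)\<^sup>2) = E (\<lambda>x. (E f)\<^sup>2)"
    by (intro Bochner_Integration.integral_cong) auto
  then have am: "a (length zs) = (E f)\<^sup>2"
    by (simp add: a_def prod.P.prob_space)
  have "2 * a (Suc k) \<le> a k + a (Suc (Suc k))" if k: "Suc (Suc k) \<le> length zs" for k
  proof -
    have ij: "zs ! k \<in> set zs" "zs ! Suc k \<in> set zs" "zs ! k \<noteq> zs ! Suc k"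
      using k zs(1) by (auto simp: nth_eq_iff_index_eq)
    have notin: "zs ! k \<notin> set (take k zs)" "zs ! Suc k \<notin> set (take k zs)"
      using k zs(1) by (auto simp: in_set_conv_nth nth_eq_iff_index_eq)
    have sub: "set (take k zs) \<subseteq> I"
      using zs(2) set_take_subset by fastforce
    show ?thesis
      using E_avg_avg_power2_convex[OF bdd_measurable_fold[OF f sub]
          symmetric2_fold[OF sym[OF ij] notin] _ _ ij(3)] ij zs(2) k
      by (simp add: a_def take_Suc_conv_app_nth subset_iff)
  qed
  from convex_sequence_bound[of "length zs" a l, OF this l] show ?thesis
    unfolding am by (simp add: a_def)
qed

theorem covariance_bound_bdd:
  assumes f: "bdd_measurable f" and g: "bdd_measurable g"
    and ST: "S \<subseteq> I" "T \<subseteq> I" "S \<noteq> {}" "T \<noteq> {}"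
    and symf: "\<And>i j. i \<in> S \<Longrightarrow> j \<in> S \<Longrightarrow> i \<noteq> j \<Longrightarrow> symmetric2 i j f"
    and symg: "\<And>i j. i \<in> T \<Longrightarrow> j \<in> T \<Longrightarrow> i \<noteq> j \<Longrightarrow> symmetric2 i j g"
    and invf: "\<And>i. i \<in> I - S \<Longrightarrow> invariant i f"
    and invg: "\<And>i. i \<in> I - T \<Longrightarrow> invariant i g"
  shows "E (\<lambda>x. f x * g x) - E f * E g \<le>
    card (S \<inter> T) / sqrt (card S * card T) *
    (sqrt (E (\<lambda>x. (f x)\<^sup>2) - (E f)\<^sup>2) * sqrt (E (\<lambda>x. (g x)\<^sup>2) - (E g)\<^sup>2))"
proof -
  have fin: "finite S" "finite T"
    using ST finite_index finite_subset by blast+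
  obtain xs where xs: "distinct xs" "set xs = S - T"
    using finite_distinct_list fin by (metis finite_Diff)
  obtain ys where ys: "distinct ys" "set ys = T - S"
    using finite_distinct_list fin by (metis finite_Diff)
  obtain cs where cs: "distinct cs" "set cs = S \<inter> T"
    using finite_distinct_list fin by (metis finite_Int)
  have disj: "(S - T) \<inter> (S \<inter> T) = {}" "(T - S) \<inter> (S \<inter> T) = {}"
    by auto
  have len: "length cs = card (S \<inter> T)" "length (xs @ cs) = card S" "length (rev ys @ cs) = card T"
    using distinct_card[of cs] distinct_card[of "xs @ cs"] distinct_card[of "rev ys @ cs"] xs ys cs
      Un_Diff_Int[of S T] Un_Diff_Int[of T S] disj
    by (auto simp: Int_commute)
  have diff: "card S - length xs = card (S \<inter> T)" "card T - length ys = card (S \<inter> T)"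
    using len by auto
  \<comment> \<open>\<open>f'\<close> and \<open>g'\<close> are the conditional expectations of
    \<open>f\<close> and \<open>g\<close> given the shared coordinates. \<open>ys\<close> is
    reversed because it reaches \<open>g\<close> through \<open>E_fold_mult\<close>.\<close>
  define f' where "f' = fold avg xs f"
  define g' where "g' = fold avg (rev ys) g"
  have f': "bdd_measurable f'" "E f' = E f"
    unfolding f'_def using f xs ST by (auto intro!: bdd_measurable_fold E_fold)
  have g': "bdd_measurable g'" "E g' = E g"
    unfolding g'_def using g ys ST by (auto intro!: bdd_measurable_fold E_fold)
  \<comment> \<open>Averages over \<open>T - S\<close> leave \<open>f\<close> unchanged, so they can
    be inserted there and moved to \<open>g\<close> by self-adjointness. Then averages over
    \<open>S - T\<close>, which leave \<open>g'\<close> unchanged, are moved to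
    \<open>f\<close>.\<close>
  have "E (\<lambda>x. f x * g x) = E (\<lambda>x. fold avg ys f x * g x)"
    using invf ys ST by (subst fold_invariant) auto
  also have "\<dots> = E (\<lambda>x. f x * g' x)"
    unfolding g'_def using f g ys ST by (intro E_fold_mult) auto
  also have "\<dots> = E (\<lambda>x. f x * fold avg (rev xs) g' x)"
    using invg xs ST by (subst fold_invariant) (auto simp: g'_def intro!: invariant_fold)
  also have "\<dots> = E (\<lambda>x. f' x * g' x)"
    unfolding f'_def using f g' xs ST by (intro E_fold_mult[symmetric]) auto
  finally have fg: "E (\<lambda>x. f x * g x) = E (\<lambda>x. f' x * g' x)" .
  define vf where "vf = E (\<lambda>x. (f x)\<^sup>2) - (E f)\<^sup>2"
  define vg where "vg = E (\<lambda>x. (g x)\<^sup>2) - (E g)\<^sup>2"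
  \<comment> \<open>\<open>xs @ cs\<close> enumerates \<open>S\<close> with the private coordinates
    first, so \<open>f'\<close> is the average over the prefix of length \<open>length xs\<close>,
    and \<open>card (S \<inter> T)\<close> coordinates remain.\<close>
  have F: "card S * (E (\<lambda>x. (f' x)\<^sup>2) - (E f)\<^sup>2) \<le> card (S \<inter> T) * vf"
  proof -
    have "real (length (xs @ cs)) * (E (\<lambda>x. (fold avg (take (length xs) (xs @ cs)) f x)\<^sup>2) - (E f)\<^sup>2)
        \<le> real (length (xs @ cs) - length xs) * vf"
      unfolding vf_def using f xs cs ST symf invf by (intro variance_fold_le) auto
    then show ?thesis
      unfolding len(2) diff by (simp add: f'_def)
  qed
  have G: "card T * (E (\<lambda>x. (g' x)\<^sup>2) - (E g)\<^sup>2) \<le> card (S \<inter> T) * vg"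
  proof -
    have "real (length (rev ys @ cs)) * (E (\<lambda>x. (fold avg (take (length ys) (rev ys @ cs)) g x)\<^sup>2) - (E g)\<^sup>2)
        \<le> real (length (rev ys @ cs) - length ys) * vg"
      unfolding vg_def using g ys cs ST symg invg by (intro variance_fold_le) auto
    then show ?thesis
      unfolding len(3) diff by (simp add: g'_def)
  qed
  \<comment> \<open>Taken with \<open>u = v\<close>, this also identifies the differences of second
    moments as variances, hence as nonnegative.\<close>
  have centred: "E (\<lambda>x. (u x - E u) * (v x - E v)) = E (\<lambda>x. u x * v x) - E u * E v"
    if "bdd_measurable u" "bdd_measurable v" for u v
    using integrable_bdd_measurable[OF that(1)] integrable_bdd_measurable[OF that(2)]
      integrable_bdd_measurable[OF bdd_measurable_mult[OF that]]
    by (simp add: algebra_simps prod.P.prob_space)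
  have "E (\<lambda>x. f x * g x) - E f * E g = E (\<lambda>x. (f' x - E f') * (g' x - E g'))"
    using centred[OF f'(1) g'(1)] fg f'(2) g'(2) by simp
  also have "\<dots> \<le> sqrt (E (\<lambda>x. (f' x - E f')\<^sup>2)) * sqrt (E (\<lambda>x. (g' x - E g')\<^sup>2))"
    using E_Cauchy_Schwarz[of "\<lambda>x. f' x - E f'" "\<lambda>x. g' x - E g'"] f' g'
    by (simp add: bdd_measurable_diff abs_le_iff)
  also have "\<dots> = sqrt (E (\<lambda>x. (f' x)\<^sup>2) - (E f)\<^sup>2) * sqrt (E (\<lambda>x. (g' x)\<^sup>2) - (E g)\<^sup>2)"
    using centred[OF f'(1) f'(1)] centred[OF g'(1) g'(1)] f'(2) g'(2)
    by (simp add: power2_eq_square)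
  also have "\<dots> \<le> sqrt (card (S \<inter> T) * vf / card S) * sqrt (card (S \<inter> T) * vg / card T)"
  proof (intro mult_mono real_sqrt_le_mono)
    have "0 < card S" "0 < card T"
      using fin ST by (auto simp: card_gt_0_iff)
    then show "E (\<lambda>x. (f' x)\<^sup>2) - (E f)\<^sup>2 \<le> card (S \<inter> T) * vf / card S"
        "E (\<lambda>x. (g' x)\<^sup>2) - (E g)\<^sup>2 \<le> card (S \<inter> T) * vg / card T"
      using F G by (auto simp: field_simps)
    have "E (\<lambda>x. (g' x)\<^sup>2) - (E g)\<^sup>2 = E (\<lambda>x. (g' x - E g')\<^sup>2)"
      using centred[OF g'(1) g'(1)] g'(2) by (simp add: power2_eq_square)
    also have "0 \<le> \<dots>" by simp
    finally show "0 \<le> sqrt (E (\<lambda>x. (g' x)\<^sup>2) - (E g)\<^sup>2)"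
      by (rule real_sqrt_ge_zero)
    have "vf = E (\<lambda>x. (f x - E f)\<^sup>2)"
      using centred[OF f f] by (simp add: power2_eq_square vf_def)
    also have "0 \<le> \<dots>" by simp
    finally show "0 \<le> sqrt (card (S \<inter> T) * vf / card S)"
      by simp
  qed
  also have "\<dots> = card (S \<inter> T) / sqrt (card S * card T) * (sqrt vf * sqrt vg)"
    by (simp add: real_sqrt_mult real_sqrt_divide)
  finally show ?thesis
    by (simp add: vf_def vg_def)
qed

end

section \<open>Extension to square-integrable functions, and functions of sums of Dirac
  measures\<close>

context finite_power_prob
begin

text \<open>Truncation acts on values only, so truncated functions inherit symmetry and invariance.
  The bounded case applies to them, and each term converges by dominated convergence.\<close>

theorem covariance_bound:
  assumes f: "f \<in> borel_measurable power_measure" "integrable power_measure (\<lambda>x. (f x)\<^sup>2)"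
    and g: "g \<in> borel_measurable power_measure" "integrable power_measure (\<lambda>x. (g x)\<^sup>2)"
    and ST: "S \<subseteq> I" "T \<subseteq> I" "S \<noteq> {}" "T \<noteq> {}"
    and symf: "\<And>i j. i \<in> S \<Longrightarrow> j \<in> S \<Longrightarrow> i \<noteq> j \<Longrightarrow> symmetric2 i j f"
    and symg: "\<And>i j. i \<in> T \<Longrightarrow> j \<in> T \<Longrightarrow> i \<noteq> j \<Longrightarrow> symmetric2 i j g"
    and invf: "\<And>i. i \<in> I - S \<Longrightarrow> invariant i f"
    and invg: "\<And>i. i \<in> I - T \<Longrightarrow> invariant i g"
  shows "E (\<lambda>x. f x * g x) - E f * E g \<le>
    card (S \<inter> T) / sqrt (card S * card T) *
    (sqrt (E (\<lambda>x. (f x)\<^sup>2) - (E f)\<^sup>2) * sqrt (E (\<lambda>x. (g x)\<^sup>2) - (E g)\<^sup>2))"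
proof -
  define t :: "nat \<Rightarrow> real \<Rightarrow> real" where "t N y = max (- real N) (min (real N) y)" for N y
  have t_le: "\<bar>t N y\<bar> \<le> \<bar>y\<bar>" "\<bar>t N y\<bar> \<le> N" for N y
    by (auto simp: t_def)
  have t_lim: "(\<lambda>N. t N y) \<longlonglongrightarrow> y" for y
  proof (rule tendsto_eventually)
    obtain N0 :: nat where "\<bar>y\<bar> \<le> real N0"
      using real_arch_simple by blast
    then show "\<forall>\<^sub>F N in sequentially. t N y = y"
      by (intro eventually_sequentiallyI[of N0]) (auto simp: t_def)
  qed
  have t_meas [measurable]: "t N \<in> borel_measurable borel" for N
    unfolding t_def [abs_def] by measurable
  note f(1) [measurable] g(1) [measurable]
  have bdd: "bdd_measurable (\<lambda>x. t N (h x))" if [measurable]: "h \<in> borel_measurable power_measure" for N h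
    using t_le(2) by (auto simp: bdd_measurable_def)
  have lim_E: "(\<lambda>N. E (\<lambda>x. t N (h x))) \<longlonglongrightarrow> E h"
    if [measurable]: "h \<in> borel_measurable power_measure"
      and "integrable power_measure (\<lambda>x. (h x)\<^sup>2)" for h
  proof (rule integral_dominated_convergence[where w="\<lambda>x. \<bar>h x\<bar>"])
    show "integrable power_measure (\<lambda>x. \<bar>h x\<bar>)"
      using prod.P.square_integrable_imp_integrable[OF that] by simp
  qed (auto simp: t_le intro: t_lim)
  have lim_prod: "(\<lambda>N. E (\<lambda>x. t N (h x) * t N (k x))) \<longlonglongrightarrow> E (\<lambda>x. h x * k x)"
    if [measurable]: "h \<in> borel_measurable power_measure" "k \<in> borel_measurable power_measure"
      and int: "integrable power_measure (\<lambda>x. (h x)\<^sup>2)" "integrable power_measure (\<lambda>x. (k x)\<^sup>2)"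
    for h k
    by (rule integral_dominated_convergence[where w="\<lambda>x. \<bar>h x * k x\<bar>", OF _ _ integrable_abs[OF integrable_mult_of_squares[OF that]]])
      (auto simp: abs_mult t_le intro!: tendsto_mult t_lim mult_mono)
  \<comment> \<open>Squares are written as products so that \<open>lim_prod\<close> with
    \<open>h = k\<close> covers the variances too.\<close>
  have bound: "E (\<lambda>x. t N (f x) * t N (g x)) - E (\<lambda>x. t N (f x)) * E (\<lambda>x. t N (g x)) \<le>
    card (S \<inter> T) / sqrt (card S * card T) *
    (sqrt (E (\<lambda>x. t N (f x) * t N (f x)) - (E (\<lambda>x. t N (f x)))\<^sup>2) *
     sqrt (E (\<lambda>x. t N (g x) * t N (g x)) - (E (\<lambda>x. t N (g x)))\<^sup>2))" for N
    using covariance_bound_bdd[OF bdd[OF f(1), of N] bdd[OF g(1), of N] ST]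
      symf symg invf invg by (simp add: symmetric2_def invariant_def power2_eq_square)
  have "(\<lambda>N. E (\<lambda>x. t N (f x) * t N (g x)) - E (\<lambda>x. t N (f x)) * E (\<lambda>x. t N (g x)))
      \<longlonglongrightarrow> E (\<lambda>x. f x * g x) - E f * E g"
    by (intro tendsto_intros lim_E lim_prod f g)
  moreover have "(\<lambda>N. card (S \<inter> T) / sqrt (card S * card T) *
      (sqrt (E (\<lambda>x. t N (f x) * t N (f x)) - (E (\<lambda>x. t N (f x)))\<^sup>2) *
       sqrt (E (\<lambda>x. t N (g x) * t N (g x)) - (E (\<lambda>x. t N (g x)))\<^sup>2)))
      \<longlonglongrightarrow> card (S \<inter> T) / sqrt (card S * card T) *
        (sqrt (E (\<lambda>x. f x * f x) - (E f)\<^sup>2) * sqrt (E (\<lambda>x. g x * g x) - (E g)\<^sup>2))"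
    by (intro tendsto_intros lim_E lim_prod f g)
  ultimately have "E (\<lambda>x. f x * g x) - E f * E g \<le>
    card (S \<inter> T) / sqrt (card S * card T) *
    (sqrt (E (\<lambda>x. f x * f x) - (E f)\<^sup>2) * sqrt (E (\<lambda>x. g x * g x) - (E g)\<^sup>2))"
    by (rule LIMSEQ_le) (use bound in auto)
  then show ?thesis
    by (simp add: power2_eq_square)
qed

lemma symmetric2_sum_dirac:
  assumes "i \<in> S" "j \<in> S" "i \<noteq> j"
  shows "symmetric2 i j (\<lambda>x. \<phi> (sum_dirac F S x))"
proof -
  have "sum_dirac F S (x(i := a, j := b)) = sum_dirac F S (x(i := b, j := a))" for x a b
  proof -
    \<comment> \<open>Exchanging the entries at \<open>i\<close> and \<open>j\<close> only permutes
      the summands.\<close>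
    have "bij_betw (Transposition.transpose i j) S S"
      using assms by (intro permutes_imp_bij permutes_swap_id)
    then have "(\<Sum>k\<in>S. emeasure (return F ((x(i := b, j := a)) k)) A) =
        (\<Sum>k\<in>S. emeasure (return F ((x(i := b, j := a)) (Transposition.transpose i j k))) A)" for A
      by (rule sum.reindex_bij_betw[symmetric])
    moreover have "(x(i := b, j := a)) (Transposition.transpose i j k) = (x(i := a, j := b)) k" for k
      using assms(3) by (auto simp: Transposition.transpose_def)
    ultimately show ?thesis
      unfolding sum_dirac_def by simp
  qed
  then show ?thesis
    by (simp add: symmetric2_def)
qed

lemma invariant_sum_dirac:
  assumes "i \<notin> S"
  shows "invariant i (\<lambda>x. \<phi> (sum_dirac F S x))"
proof -
  have "(\<Sum>k\<in>S. emeasure (return F ((x(i := y)) k)) A) = (\<Sum>k\<in>S. emeasure (return F (x k)) A)" for x y A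
    using assms by (intro sum.cong) auto
  then show ?thesis
    by (simp add: invariant_def sum_dirac_def)
qed

end

lemma measurable_measure_finite_measure_algebra:
  "A \<in> sets F \<Longrightarrow> (\<lambda>\<nu>. measure \<nu> A) \<in> borel_measurable (finite_measure_algebra F)"
  unfolding measure_def by measurable

lemma measure_sum_dirac:
  assumes "A \<in> sets F" "finite S"
  shows "measure (sum_dirac F S x) A = (\<Sum>i\<in>S. indicator A (x i))"
proof -
  have "emeasure (sum_dirac F S x) A = ennreal (\<Sum>i\<in>S. indicator A (x i))"
    using assms by (simp add: emeasure_sum_dirac ennreal_indicator flip: sum_ennreal)
  then show ?thesis
    by (simp add: measure_def sum_nonneg)
qed

section \<open>Non-degeneracy, and second moments of sums of independent variables\<close>

context prob_space
begin

lemma nondegenerate_imp_event: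
  assumes X: "X \<in> measurable M F" and "\<not> degenerate F X"
  obtains A where "A \<in> sets F" "0 < prob (X -` A \<inter> space M)" "prob (X -` A \<inter> space M) < 1"
proof -
  note X [measurable]
  \<comment> \<open>The arctangent makes the non-constant function bounded, so that it can be cut at its mean.\<close>
  obtain \<phi> :: "'b \<Rightarrow> real" where \<phi> [measurable]: "\<phi> \<in> borel_measurable F"
    and nc: "\<And>c. \<not> (AE \<omega> in M. \<phi> (X \<omega>) = c)"
    using assms(2) by (auto simp: degenerate_def)
  define Y where "Y \<omega> = arctan (\<phi> (X \<omega>))" for \<omega>
  have Y [measurable]: "Y \<in> borel_measurable M"
    unfolding Y_def by measurable
  have "\<bar>Y \<omega>\<bar> \<le> pi / 2" for \<omega>
    using arctan_lbound[of "\<phi> (X \<omega>)"] arctan_ubound[of "\<phi> (X \<omega>)"] by (auto simp: Y_def)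
  then have int: "integrable M Y"
    by (intro integrable_const_bound[where B="pi/2"]) auto
  define A where "A = {y \<in> space F. arctan (\<phi> y) > expectation Y}"
  have A: "A \<in> sets F"
    unfolding A_def by measurable
  have vim: "X -` A \<inter> space M = {\<omega> \<in> space M. Y \<omega> > expectation Y}"
    using measurable_space[OF X] by (auto simp: A_def Y_def)
  \<comment> \<open>The tangent inverts the arctangent, so a constant \<open>Y\<close> would make
    \<open>\<phi> (X \<omega>)\<close> almost surely constant.\<close>
  have nc': False if "AE \<omega> in M. Y \<omega> = expectation Y"
  proof (rule notE[OF nc])
    show "AE \<omega> in M. \<phi> (X \<omega>) = tan (expectation Y)"
      using that by eventually_elim (metis Y_def tan_arctan)
  qed
  \<comment> \<open>If the event had probability 0 or 1, \<open>Y\<close> would almost surely stay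
    on one side of its own mean and hence equal it.\<close>
  have "prob (X -` A \<inter> space M) \<noteq> 0"
  proof
    assume "prob (X -` A \<inter> space M) = 0"
    then have "AE \<omega> in M. \<omega> \<notin> X -` A \<inter> space M"
      using A by (intro prob_eq_0[THEN iffD1]) measurable
    then have le: "AE \<omega> in M. 0 \<le> expectation Y - Y \<omega>"
      by (rule AE_mp) (auto simp: vim)
    have "AE \<omega> in M. expectation Y - Y \<omega> = 0"
      using integral_nonneg_eq_0_iff_AE[OF _ le] int by (simp add: prob_space)
    then show False
      by (intro nc') (auto elim!: AE_mp)
  qed
  moreover have "prob (X -` A \<inter> space M) \<noteq> 1"
  proof
    assume "prob (X -` A \<inter> space M) = 1"
    then have "AE \<omega> in M. \<omega> \<in> X -` A \<inter> space M"
      using A by (intro prob_eq_1[THEN iffD1]) measurable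
    then have gt: "AE \<omega> in M. Y \<omega> > expectation Y"
      by (rule AE_mp) (auto simp: vim)
    then have ge: "AE \<omega> in M. 0 \<le> Y \<omega> - expectation Y"
      by (rule AE_mp) auto
    have "AE \<omega> in M. Y \<omega> - expectation Y = 0"
      using integral_nonneg_eq_0_iff_AE[OF _ ge] int by (simp add: prob_space)
    with nc' show False by simp
  qed
  ultimately show ?thesis
    using A that[of A] measure_nonneg[of M "X -` A \<inter> space M"] prob_le_1[of "X -` A \<inter> space M"]
    by linarith
qed

text \<open>After expanding the product, independence and mean 0 remove the terms with
  \<open>i \<noteq> j\<close>; each shared index contributes \<open>q\<close>.\<close>

lemma expectation_sum_mult_sum:
  fixes Z :: "'i \<Rightarrow> 'a \<Rightarrow> real" and q :: real
  assumes indep: "indep_vars (\<lambda>_. borel) Z I"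
    and int: "\<And>i. i \<in> I \<Longrightarrow> integrable M (Z i)" "\<And>i. i \<in> I \<Longrightarrow> integrable M (\<lambda>\<omega>. Z i \<omega> * Z i \<omega>)"
    and mean: "\<And>i. i \<in> I \<Longrightarrow> expectation (Z i) = 0"
    and var: "\<And>i. i \<in> I \<Longrightarrow> expectation (\<lambda>\<omega>. Z i \<omega> * Z i \<omega>) = q"
    and ST: "finite S" "finite T" "S \<subseteq> I" "T \<subseteq> I"
  shows "expectation (\<lambda>\<omega>. (\<Sum>i\<in>S. Z i \<omega>) * (\<Sum>j\<in>T. Z j \<omega>)) = card (S \<inter> T) * q"
proof -
  have ij: "integrable M (\<lambda>\<omega>. Z i \<omega> * Z j \<omega>) \<and>
      expectation (\<lambda>\<omega>. Z i \<omega> * Z j \<omega>) = (if i = j then q else 0)"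
    if "i \<in> I" "j \<in> I" for i j
  proof (cases "i = j")
    case False
    have "indep_vars (\<lambda>_. borel) Z {i, j}"
      using indep_vars_subset[OF indep] that by auto
    from indep_vars_integrable[OF _ this] indep_vars_lebesgue_integral[OF _ this] show ?thesis
      using that False int(1) by (force simp: mean)
  qed (use that int var in auto)
  have "expectation (\<lambda>\<omega>. (\<Sum>i\<in>S. Z i \<omega>) * (\<Sum>j\<in>T. Z j \<omega>)) =
      expectation (\<lambda>\<omega>. \<Sum>i\<in>S. \<Sum>j\<in>T. Z i \<omega> * Z j \<omega>)"
    by (simp add: sum_product)
  also have "\<dots> = (\<Sum>i\<in>S. expectation (\<lambda>\<omega>. \<Sum>j\<in>T. Z i \<omega> * Z j \<omega>))"
    using ij ST by (intro Bochner_Integration.integral_sum Bochner_Integration.integrable_sum) blast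
  also have "\<dots> = (\<Sum>i\<in>S. \<Sum>j\<in>T. expectation (\<lambda>\<omega>. Z i \<omega> * Z j \<omega>))"
    using ij ST by (intro sum.cong refl Bochner_Integration.integral_sum) blast
  also have "\<dots> = (\<Sum>i\<in>S. \<Sum>j\<in>T. if i = j then q else 0)"
    using ST by (intro sum.cong refl conjunct2[OF ij]) auto
  also have "\<dots> = card (S \<inter> T) * q"
    using ST by (simp flip: sum.inter_restrict)
  finally show ?thesis .
qed

text \<open>Serves in contrapositive form: one integrable function of positive variance shows
  non-degeneracy.\<close>

lemma degenerate_imp_variance_0:
  fixes g :: "'b \<Rightarrow> real"
  assumes "degenerate F X" "g \<in> borel_measurable F" "integrable M (\<lambda>\<omega>. g (X \<omega>))"
  shows "variance (\<lambda>\<omega>. g (X \<omega>)) = 0"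
proof -
  obtain c :: real where c: "AE \<omega> in M. g (X \<omega>) = c"
    using assms(1,2) by (auto simp: degenerate_def)
  then have "expectation (\<lambda>\<omega>. g (X \<omega>)) = expectation (\<lambda>_. c)"
    using assms(3) by (intro integral_cong_AE) auto
  then have "expectation (\<lambda>\<omega>. g (X \<omega>)) = c"
    by (simp add: prob_space)
  with c have "AE \<omega> in M. (g (X \<omega>) - expectation (\<lambda>\<omega>. g (X \<omega>)))\<^sup>2 = 0"
    by (auto elim: AE_mp)
  then show ?thesis
    by (rule integral_eq_zero_AE)
qed

section \<open>The maximal correlation for two arbitrary nonempty index sets\<close>

theorem maximal_correlation_sum_dirac:
  fixes X :: "'i \<Rightarrow> 'a \<Rightarrow> 'b"
  assumes indep: "indep_vars (\<lambda>_. F) X I"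
    and ident: "\<And>i j. i \<in> I \<Longrightarrow> j \<in> I \<Longrightarrow> distr M F (X i) = distr M F (X j)"
    and nondeg: "\<And>i. i \<in> I \<Longrightarrow> \<not> degenerate F (X i)"
    and I: "finite I" and ST: "S \<subseteq> I" "T \<subseteq> I" "S \<noteq> {}" "T \<noteq> {}"
  shows "maximal_correlation
      (finite_measure_algebra F) (\<lambda>\<omega>. sum_dirac F S (\<lambda>i. X i \<omega>))
      (finite_measure_algebra F) (\<lambda>\<omega>. sum_dirac F T (\<lambda>i. X i \<omega>))
    = card (S \<inter> T) / sqrt (card S * card T)"
proof -
  have fin: "finite S" "finite T"
    using I ST finite_subset by blast+
  have X [measurable]: "X i \<in> measurable M F" if "i \<in> I" for i
    using indep that by (simp add: indep_vars_def2)
  obtain i0 where i0: "i0 \<in> I"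
    using ST by auto
  define P where "P = distr M F (X i0)"
  have distr_X: "distr M F (X i) = P" if "i \<in> I" for i
    using ident[OF that i0] by (simp add: P_def)
  have sets_P [simp, measurable_cong]: "sets P = sets F"
    by (simp add: P_def)
  interpret pow: finite_power_prob P I
    using I X[OF i0] by (intro finite_power_prob.intro finite_power_prob_axioms.intro)
      (auto simp: P_def prob_space_distr)
  \<comment> \<open>Restricted to \<open>I\<close> because points of a product space are
    extensional. By independence and equality of the laws, \<open>W\<close> has the power measure as
    its distribution.\<close>
  define W where "W \<omega> = (\<lambda>i\<in>I. X i \<omega>)" for \<omega>
  have W: "W \<in> measurable M pow.power_measure"
    unfolding W_def [abs_def] by (intro measurable_restrict) simp
  have sets_pow: "sets (Pi\<^sub>M I (\<lambda>_. F)) = sets pow.power_measure"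
    by (intro sets_PiM_cong) simp_all
  have distr_W: "distr M pow.power_measure W = pow.power_measure"
  proof -
    have "distr M pow.power_measure W = distr M (Pi\<^sub>M I (\<lambda>_. F)) (\<lambda>\<omega>. \<lambda>i\<in>I. X i \<omega>)"
      by (intro distr_cong) (simp_all add: W_def sets_pow)
    also have "\<dots> = Pi\<^sub>M I (\<lambda>i. distr M F (X i))"
      using indep_vars_iff_distr_eq_PiM'[of I X "\<lambda>_. F"] indep i0 X by auto
    also have "\<dots> = pow.power_measure"
      by (intro PiM_cong distr_X) simp_all
    finally show ?thesis .
  qed

  define \<xi> where "\<xi> R \<omega> = sum_dirac F R (\<lambda>i. X i \<omega>)" for R \<omega>
  let ?N = "finite_measure_algebra F"
  let ?c = "card (S \<inter> T) / sqrt (card S * card T)"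
  have \<xi> [measurable]: "\<xi> R \<in> measurable M ?N" if "R \<subseteq> I" for R
    unfolding \<xi>_def [abs_def] using that X I by (intro measurable_sum_dirac) (auto intro: finite_subset)
  have \<xi>_W: "\<xi> R \<omega> = sum_dirac F R (W \<omega>)" if "R \<subseteq> I" for R \<omega>
    unfolding \<xi>_def sum_dirac_def W_def using that
    by (intro arg_cong[where f="measure_of _ _"] ext sum.cong) auto
  have dirac_meas: "sum_dirac F R \<in> measurable pow.power_measure ?N" if "R \<subseteq> I" for R
  proof -
    have "(\<lambda>x. sum_dirac F R (\<lambda>i. x i)) \<in> measurable pow.power_measure ?N"
      using that I by (intro measurable_sum_dirac) (auto intro: finite_subset)
    then show ?thesis by simp
  qed
  \<comment> \<open>Expectations are carried along \<open>W\<close> to the power space, where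
    \<open>covariance_bound\<close> applies to the functions \<open>u\<close> and \<open>v\<close>
    of the coordinates.\<close>
  have upper: "correlation (\<lambda>\<omega>. \<phi> (\<xi> S \<omega>)) (\<lambda>\<omega>. \<psi> (\<xi> T \<omega>)) \<le> ?c"
    if \<phi>: "admissible ?N (\<xi> S) \<phi>" and \<psi>: "admissible ?N (\<xi> T) \<psi>" for \<phi> \<psi>
  proof -
    define u where "u x = \<phi> (sum_dirac F S x)" for x
    define v where "v x = \<psi> (sum_dirac F T x)" for x
    have [measurable]: "u \<in> borel_measurable pow.power_measure" "v \<in> borel_measurable pow.power_measure"
      unfolding u_def [abs_def] v_def [abs_def] using \<phi> \<psi> ST
      by (auto simp: admissible_def intro!: measurable_compose[OF dirac_meas])
    have E: "pow.E h = expectation (\<lambda>\<omega>. h (W \<omega>))"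
      if "h \<in> borel_measurable pow.power_measure" for h :: "_ \<Rightarrow> real"
      using integral_distr[OF W that] by (simp add: distr_W)
    have int: "integrable pow.power_measure h = integrable M (\<lambda>\<omega>. h (W \<omega>))"
      if "h \<in> borel_measurable pow.power_measure" for h :: "_ \<Rightarrow> real"
      using integrable_distr_eq[OF W that] by (simp add: distr_W)
    have uv: "\<phi> (\<xi> S \<omega>) = u (W \<omega>)" "\<psi> (\<xi> T \<omega>) = v (W \<omega>)" for \<omega>
      using ST by (simp_all add: u_def v_def \<xi>_W)
    have sq: "integrable M (\<lambda>\<omega>. (u (W \<omega>))\<^sup>2)" "integrable M (\<lambda>\<omega>. (v (W \<omega>))\<^sup>2)"
      and pos: "variance (\<lambda>\<omega>. u (W \<omega>)) > 0" "variance (\<lambda>\<omega>. v (W \<omega>)) > 0"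
      using \<phi> \<psi> by (simp_all add: admissible_def uv)
    have meas: "(\<lambda>\<omega>. u (W \<omega>)) \<in> borel_measurable M" "(\<lambda>\<omega>. v (W \<omega>)) \<in> borel_measurable M"
      using W by measurable
    note int1 = square_integrable_imp_integrable[OF meas(1) sq(1)]
      square_integrable_imp_integrable[OF meas(2) sq(2)]
    have "integrable M (\<lambda>\<omega>. u (W \<omega>) * v (W \<omega>))"
      using meas sq by (intro integrable_mult_of_squares)
    then have "covariance (\<lambda>\<omega>. u (W \<omega>)) (\<lambda>\<omega>. v (W \<omega>)) =
        pow.E (\<lambda>x. u x * v x) - pow.E u * pow.E v"
      using int1 by (simp add: covariance_def E algebra_simps prob_space)
    also have "\<dots> \<le> ?c * (sqrt (pow.E (\<lambda>x. (u x)\<^sup>2) - (pow.E u)\<^sup>2) *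
        sqrt (pow.E (\<lambda>x. (v x)\<^sup>2) - (pow.E v)\<^sup>2))"
    proof (rule pow.covariance_bound)
      show "integrable pow.power_measure (\<lambda>x. (u x)\<^sup>2)" "integrable pow.power_measure (\<lambda>x. (v x)\<^sup>2)"
        using sq by (simp_all add: int)
      show "pow.symmetric2 i j u" if "i \<in> S" "j \<in> S" "i \<noteq> j" for i j
        unfolding u_def [abs_def] using that by (rule pow.symmetric2_sum_dirac)
      show "pow.symmetric2 i j v" if "i \<in> T" "j \<in> T" "i \<noteq> j" for i j
        unfolding v_def [abs_def] using that by (rule pow.symmetric2_sum_dirac)
      show "pow.invariant i u" if "i \<in> I - S" for i
        unfolding u_def [abs_def] using that by (auto intro: pow.invariant_sum_dirac)
      show "pow.invariant i v" if "i \<in> I - T" for i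
        unfolding v_def [abs_def] using that by (auto intro: pow.invariant_sum_dirac)
    qed (use ST in auto)
    also have "\<dots> = ?c * (sqrt (variance (\<lambda>\<omega>. u (W \<omega>))) * sqrt (variance (\<lambda>\<omega>. v (W \<omega>))))"
      by (simp only: E variance_eq[OF int1(1) sq(1)] variance_eq[OF int1(2) sq(2)]
          borel_measurable_power \<open>u \<in> _\<close> \<open>v \<in> _\<close>)
    finally show ?thesis
      using pos by (simp add: correlation_def uv divide_le_eq)
  qed

  obtain A where A: "A \<in> sets F" "0 < prob (X i0 -` A \<inter> space M)" "prob (X i0 -` A \<inter> space M) < 1"
    by (rule nondegenerate_imp_event[OF X[OF i0] nondeg[OF i0]])
  define p where "p = prob (X i0 -` A \<inter> space M)"
  \<comment> \<open>The variance of a Bernoulli variable with mean \<open>p\<close>, here of the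
    indicator of \<open>A\<close> at \<open>X i\<close>.\<close>
  define q where "q = p * (1 - p)"
  have "q > 0"
    using A by (simp add: q_def p_def)
  define B :: "'i \<Rightarrow> 'a \<Rightarrow> real" where "B i \<omega> = indicator A (X i \<omega>)" for i \<omega>
  have B: "B i \<in> borel_measurable M" if "i \<in> I" for i
    unfolding B_def [abs_def]
    by (rule measurable_compose[OF X[OF that] borel_measurable_indicator[OF A(1)]])
  have B_int: "integrable M (B i)" if "i \<in> I" for i
    using B[OF that] by (intro integrable_const_bound[where B=1]) (auto simp: B_def)
  have B_mean: "expectation (B i) = p" if "i \<in> I" for i
  proof -
    have "expectation (B i) = expectation (indicator (X i -` A \<inter> space M))"
      by (intro Bochner_Integration.integral_cong) (auto simp: B_def indicator_def)
    also have "\<dots> = prob (X i -` A \<inter> space M)"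
      by simp
    also have "\<dots> = measure (distr M F (X i)) A"
      by (rule measure_distr[OF X[OF that] A(1), symmetric])
    also have "\<dots> = p"
      unfolding distr_X[OF that] P_def p_def by (rule measure_distr[OF X[OF i0] A(1)])
    finally show ?thesis .
  qed
  define Z where "Z i \<omega> = B i \<omega> - p" for i \<omega>
  have Z_indep: "indep_vars (\<lambda>_. borel) Z I"
    unfolding Z_def [abs_def] B_def using A(1)
    by (intro indep_vars_compose2[OF indep, where Y="\<lambda>_ y. indicator A y - p"]) auto
  have Z_int: "integrable M (Z i)" and Z_mean: "expectation (Z i) = 0"
    and ZZ_int: "integrable M (\<lambda>\<omega>. Z i \<omega> * Z i \<omega>)"
    and ZZ: "expectation (\<lambda>\<omega>. Z i \<omega> * Z i \<omega>) = q" if "i \<in> I" for i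
  proof -
    \<comment> \<open>An indicator equals its own square, which makes the square of
      \<open>Z i\<close> affine in \<open>B i\<close>.\<close>
    have sq: "(\<lambda>\<omega>. Z i \<omega> * Z i \<omega>) = (\<lambda>\<omega>. (1 - 2 * p) * B i \<omega> + p\<^sup>2)"
      by (auto simp: Z_def B_def fun_eq_iff indicator_def power2_eq_square algebra_simps)
    show "integrable M (Z i)" "expectation (Z i) = 0"
      using B_int[OF that] by (simp_all add: Z_def [abs_def] B_mean[OF that] prob_space)
    show "integrable M (\<lambda>\<omega>. Z i \<omega> * Z i \<omega>)" "expectation (\<lambda>\<omega>. Z i \<omega> * Z i \<omega>) = q"
      unfolding sq using B_int[OF that]
      by (simp_all add: B_mean[OF that] prob_space q_def power2_eq_square algebra_simps)
  qed
  let ?\<mu> = "\<lambda>\<nu>. measure \<nu> A"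
  have \<mu>_\<xi>: "?\<mu> (\<xi> R \<omega>) = (\<Sum>i\<in>R. B i \<omega>)" if "R \<subseteq> I" for R \<omega>
    using A(1) finite_subset[OF that I] by (simp add: \<xi>_def measure_sum_dirac B_def)
  \<comment> \<open>Evaluating the random measure at \<open>A\<close> counts the indices whose value
    lies in \<open>A\<close>; centring it leaves a sum of independent centred variables.\<close>
  have centred: "?\<mu> (\<xi> R \<omega>) - expectation (\<lambda>\<omega>. ?\<mu> (\<xi> R \<omega>)) = (\<Sum>i\<in>R. Z i \<omega>)" if "R \<subseteq> I" for R \<omega>
  proof -
    have "expectation (\<lambda>\<omega>. ?\<mu> (\<xi> R \<omega>)) = (\<Sum>i\<in>R. p)"
      using that B_int B_mean by (simp add: \<mu>_\<xi> subset_iff)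
    then show ?thesis
      using that by (simp add: \<mu>_\<xi> Z_def sum_subtractf)
  qed
  have cov: "covariance (\<lambda>\<omega>. ?\<mu> (\<xi> R \<omega>)) (\<lambda>\<omega>. ?\<mu> (\<xi> R' \<omega>)) = card (R \<inter> R') * q"
    if "R \<subseteq> I" "R' \<subseteq> I" for R R'
    unfolding covariance_def centred[OF that(1)] centred[OF that(2)]
    using that I Z_int ZZ_int Z_mean ZZ
    by (intro expectation_sum_mult_sum[OF Z_indep]) (auto intro: finite_subset)
  have var: "variance (\<lambda>\<omega>. ?\<mu> (\<xi> R \<omega>)) = card R * q" if "R \<subseteq> I" for R
    using cov[OF that that] by (simp add: covariance_def power2_eq_square)
  have \<mu>_le: "\<bar>?\<mu> (\<xi> R \<omega>)\<bar> \<le> card R" if "R \<subseteq> I" for R \<omega>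
    using sum_bounded_above[of R "\<lambda>i. B i \<omega>" 1]
    by (simp add: \<mu>_\<xi>[OF that] B_def indicator_def sum_nonneg)
  have \<mu>_meas: "(\<lambda>\<omega>. ?\<mu> (\<xi> R \<omega>)) \<in> borel_measurable M" if "R \<subseteq> I" for R
    using measurable_compose[OF \<xi>[OF that] measurable_measure_finite_measure_algebra[OF A(1)]] .
  have adm: "admissible ?N (\<xi> R) ?\<mu>" if "R \<subseteq> I" "R \<noteq> {}" for R
    unfolding admissible_def
  proof (intro conjI)
    show "?\<mu> \<in> borel_measurable ?N"
      by (rule measurable_measure_finite_measure_algebra[OF A(1)])
    show "integrable M (\<lambda>\<omega>. (?\<mu> (\<xi> R \<omega>))\<^sup>2)"
      using \<mu>_meas[OF that(1)] power_mono[OF \<mu>_le[OF that(1)], where n=2]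
      by (intro integrable_const_bound[where B="(real (card R))\<^sup>2"]) auto
    show "variance (\<lambda>\<omega>. ?\<mu> (\<xi> R \<omega>)) > 0"
      using var[OF that(1)] that finite_subset[OF that(1) I] \<open>q > 0\<close> by (simp add: card_gt_0_iff)
  qed
  \<comment> \<open>Excludes the branch of \<open>maximal_correlation\<close> with value 0.\<close>
  have nondeg_\<xi>: "\<not> degenerate ?N (\<xi> R)" if "R \<subseteq> I" "R \<noteq> {}" for R
  proof
    assume "degenerate ?N (\<xi> R)"
    moreover have "integrable M (\<lambda>\<omega>. ?\<mu> (\<xi> R \<omega>))"
      using \<mu>_meas[OF that(1)] \<mu>_le[OF that(1)]
      by (intro integrable_const_bound[where B="card R"]) auto
    ultimately have "variance (\<lambda>\<omega>. ?\<mu> (\<xi> R \<omega>)) = 0"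
      by (rule degenerate_imp_variance_0[OF _ measurable_measure_finite_measure_algebra[OF A(1)]])
    with adm[OF that] show False
      by (simp add: admissible_def)
  qed
  \<comment> \<open>The variance \<open>q\<close> cancels, so the value depends only on the sizes of
    the index sets and of their intersection.\<close>
  have attained: "correlation (\<lambda>\<omega>. ?\<mu> (\<xi> S \<omega>)) (\<lambda>\<omega>. ?\<mu> (\<xi> T \<omega>)) = ?c"
  proof -
    have "sqrt (card S * q) * sqrt (card T * q) = sqrt (card S * card T) * q"
      using \<open>q > 0\<close> by (simp add: real_sqrt_mult)
    then show ?thesis
      unfolding correlation_def cov[OF ST(1,2)] var[OF ST(1)] var[OF ST(2)]
      using \<open>q > 0\<close> by simp
  qed
  have "Sup {correlation (\<lambda>\<omega>. \<phi> (\<xi> S \<omega>)) (\<lambda>\<omega>. \<psi> (\<xi> T \<omega>)) | \<phi> \<psi>.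
      admissible ?N (\<xi> S) \<phi> \<and> admissible ?N (\<xi> T) \<psi>} = ?c"
  \<comment> \<open>By \<open>attained\<close> the value \<open>?c\<close> belongs to the set and by
    \<open>upper\<close> it bounds the set, so the supremum is a maximum.\<close>
  proof (rule cSup_eq_maximum)
    show "?c \<in> {correlation (\<lambda>\<omega>. \<phi> (\<xi> S \<omega>)) (\<lambda>\<omega>. \<psi> (\<xi> T \<omega>)) | \<phi> \<psi>.
        admissible ?N (\<xi> S) \<phi> \<and> admissible ?N (\<xi> T) \<psi>}"
      by (rule CollectI, rule exI[of _ ?\<mu>], rule exI[of _ ?\<mu>])
        (simp only: attained adm[OF ST(1,3)] adm[OF ST(2,4)] simp_thms)
    show "r \<le> ?c" if "r \<in> {correlation (\<lambda>\<omega>. \<phi> (\<xi> S \<omega>)) (\<lambda>\<omega>. \<psi> (\<xi> T \<omega>)) | \<phi> \<psi>.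
        admissible ?N (\<xi> S) \<phi> \<and> admissible ?N (\<xi> T) \<psi>}" for r
      using that upper by blast
  qed
  then have "maximal_correlation ?N (\<xi> S) ?N (\<xi> T) = ?c"
    using nondeg_\<xi>[OF ST(1,3)] nondeg_\<xi>[OF ST(2,4)] by (simp only: maximal_correlation_def) simp
  then show ?thesis
    unfolding \<xi>_def [abs_def] .
qed

end

section \<open>Two overlapping intervals of indices\<close>

theorem corollary1p7:
  fixes M :: "'a measure" and F :: "'b measure" and X :: "nat \<Rightarrow> 'a \<Rightarrow> 'b"
    and n l m :: nat
  assumes "prob_space M"
    and "prob_space.indep_vars M (\<lambda>_. F) X {1..n}"
    and "\<forall>i\<in>{1..n}. \<forall>j\<in>{1..n}. distr M F (X i) = distr M F (X j)"
    and "\<forall>i\<in>{1..n}. \<not> prob_space.degenerate M F (X i)"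
    and "1 \<le> l + 1" and "l + 1 \<le> m" and "m \<le> n"
  shows "prob_space.maximal_correlation M
           (finite_measure_algebra F) (\<lambda>\<omega>. sum_dirac F {1..m} (\<lambda>i. X i \<omega>))
           (finite_measure_algebra F) (\<lambda>\<omega>. sum_dirac F {l+1..n} (\<lambda>j. X j \<omega>))
         = (real m - real l) / sqrt (real m * (real n - real l))"
proof -
  interpret prob_space M by fact
  have "maximal_correlation
      (finite_measure_algebra F) (\<lambda>\<omega>. sum_dirac F {1..m} (\<lambda>i. X i \<omega>))
      (finite_measure_algebra F) (\<lambda>\<omega>. sum_dirac F {l+1..n} (\<lambda>j. X j \<omega>))
    = card ({1..m} \<inter> {l+1..n}) / sqrt (card {1..m} * card {l+1..n})"
  proof (rule maximal_correlation_sum_dirac[OF assms(2)])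
    show "distr M F (X i) = distr M F (X j)" if "i \<in> {1..n}" "j \<in> {1..n}" for i j
      using assms(3) that by blast
    show "\<not> degenerate F (X i)" if "i \<in> {1..n}" for i
      using assms(4) that by blast
  qed (use assms(6,7) in auto)
  \<comment> \<open>The overlap has \<open>m - l\<close> elements. As \<open>l \<le> m\<close> and
    \<open>l \<le> n\<close>, subtraction of naturals agrees with that of reals.\<close>
  moreover have "{1..m} \<inter> {l+1..n} = {l+1..m}"
    using assms(7) by auto
  ultimately show ?thesis
    using assms(6,7) by (simp add: of_nat_diff)
qed

end
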